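(* For $\alpha \in [0,1]$ let $L_\alpha^* = \{ x \in [0,1] : \lambda^*(x) = \alpha \}$ be the $\alpha$-level set of the convergence exponent $\lambda^*$. The set $L_\alpha^*$ is dense but not $G_\delta$ in $[0,1]$ for each $\alpha \in [0,1)$, and $L_1^*$ is dense $G_\delta$ in $[0,1]$. Consequently, $L_\alpha^*$ is meager in $[0,1]$ for each $\alpha \in [0,1)$, and $L_1^*$ is comeager and nonmeager in $[0,1]$.
   Context: Pierce digits. For $x \in [0,1]$, define $d_1(x) := \lfloor 1/x \rfloor$ and $T(x) := 1 - d_1(x)\,x$ if $x \neq 0$, and $d_1(0) := \infty$, $T(0) := 0$. Here $\lfloor y \rfloor$ is the largest integer not exceeding $y$. For $n \in \mathbb{N} = \{1,2,3,\dots\}$ put $d_n(x) := d_1(T^{n-1}(x))$, where $T^{n-1}$ is the $(n-1)$-fold iterate of $T$ ($T^0$ is the identity). The sequence $(d_n(x))_{n \in \mathbb{N}}$ is the Pierce expansion digit sequence of $x$. Conventions: $\infty^s := \infty$ for $s>0$ and $c/\infty := 0$ for $c \in \mathbb{R}$. Convergence exponent: for $x \in [0,1]$, $\lambda^*(x) := \inf\{ s > 0 : \sum_{n \in \mathbb{N}} 1/(d_n(x))^s \text{ converges} \}$. The function $\lambda^*$ takes values in $[0,1]$. A subset $A$ of a topological space $X$ is meager in $X$ if it is a countable union of nowhere dense subsets of $X$, nonmeager otherwise, and comeager in $X$ if $X \setminus A$ is meager in $X$. The interval $[0,1]$ carries the subspace topology induced by the standard topology of $\mathbb{R}$. *)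

theory Defs
  imports "HOL-Analysis.Analysis"
begin

definition pierce_d1 :: "real \<Rightarrow> enat" where
  "pierce_d1 x = (if x = 0 then \<infinity> else enat (nat \<lfloor>1 / x\<rfloor>))"

definition pierce_T :: "real \<Rightarrow> real" where
  "pierce_T x = (if x = 0 then 0 else 1 - of_int \<lfloor>1 / x\<rfloor> * x)"

(* Digits are indexed from n = 1. *)
definition pierce_digit :: "nat \<Rightarrow> real \<Rightarrow> enat" where
  "pierce_digit n x = pierce_d1 ((pierce_T ^^ (n - 1)) x)"

(* 1 / d^s for s > 0, with the conventions \<infinity>^s = \<infinity> and 1 / \<infinity> = 0. *)
definition recip_powr :: "enat \<Rightarrow> real \<Rightarrow> real" where
  "recip_powr d s = (case d of enat k \<Rightarrow> 1 / real k powr s | \<infinity> \<Rightarrow> 0)"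

(* The infimum is taken in the reals; the lemmas conv_exp_set_gt_1 and
   conv_exp_in_unit_interval below show that it is a genuine one on [0,1]. *)
definition conv_exp :: "real \<Rightarrow> real" where
  "conv_exp x = Inf {s. 0 < s \<and> summable (\<lambda>n. recip_powr (pierce_digit (Suc n) x) s)}"

definition conv_exp_level :: "real \<Rightarrow> real set" where
  "conv_exp_level \<alpha> = {x \<in> {0..1}. conv_exp x = \<alpha>}"

definition dense_in :: "'a topology \<Rightarrow> 'a set \<Rightarrow> bool" where
  "dense_in X A \<longleftrightarrow> A \<subseteq> topspace X \<and> X closure_of A = topspace X"

definition nowhere_dense_in :: "'a topology \<Rightarrow> 'a set \<Rightarrow> bool" where
  "nowhere_dense_in X A \<longleftrightarrow> A \<subseteq> topspace X \<and> X interior_of (X closure_of A) = {}"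

definition meager_in :: "'a topology \<Rightarrow> 'a set \<Rightarrow> bool" where
  "meager_in X A \<longleftrightarrow>
     (\<exists>\<N>. countable \<N> \<and> (\<forall>N\<in>\<N>. nowhere_dense_in X N) \<and> A = \<Union>\<N>)"

definition nonmeager_in :: "'a topology \<Rightarrow> 'a set \<Rightarrow> bool" where
  "nonmeager_in X A \<longleftrightarrow> A \<subseteq> topspace X \<and> \<not> meager_in X A"

definition comeager_in :: "'a topology \<Rightarrow> 'a set \<Rightarrow> bool" where
  "comeager_in X A \<longleftrightarrow> A \<subseteq> topspace X \<and> meager_in X (topspace X - A)"

lemma pierce_T_bounds:
  assumes "0 < x" "x \<le> 1"
  shows "0 \<le> pierce_T x" "pierce_T x < x" "pierce_T x * of_int (\<lfloor>1 / x\<rfloor> + 1) < 1"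
proof -
  define k where "k = \<lfloor>1 / x\<rfloor>"
  have k: "of_int k \<le> 1 / x" "1 / x < of_int k + 1"
    unfolding k_def by linarith+
  have "1 \<le> 1 / x" using assms by simp
  then have k1: "1 \<le> k" unfolding k_def by linarith
  have a: "of_int k * x \<le> 1" "1 < (of_int k + 1) * x"
    using k assms by (simp_all add: field_simps)
  have T: "pierce_T x = 1 - of_int k * x"
    using assms by (simp add: pierce_T_def k_def)
  show "0 \<le> pierce_T x" using a T by simp
  show "pierce_T x < x" using a T by (simp add: algebra_simps)
  have "real_of_int k * 1 < real_of_int k * ((of_int k + 1) * x)"
    using a(2) k1 by (intro mult_strict_left_mono) auto
  then show "pierce_T x * of_int (\<lfloor>1 / x\<rfloor> + 1) < 1"
    unfolding T k_def [symmetric] by (simp add: algebra_simps)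
qed

lemma pierce_T_funpow_bounds:
  assumes "0 \<le> x" "x \<le> 1"
  shows "0 \<le> (pierce_T ^^ n) x \<and> (pierce_T ^^ n) x * real (Suc n) \<le> 1"
proof (induction n)
  case 0
  then show ?case using assms by simp
next
  case (Suc n)
  define y where "y = (pierce_T ^^ n) x"
  have y: "0 \<le> y" "y * real (Suc n) \<le> 1" using Suc by (auto simp: y_def)
  show ?case
  proof (cases "y = 0")
    case True
    then have "(pierce_T ^^ Suc n) x = 0"
      by (simp add: y_def [symmetric]) (simp add: pierce_T_def)
    then show ?thesis by simp
  next
    case False
    then have y0: "0 < y" using y by simp
    have "y * 1 \<le> y * real (Suc n)" using y0 by (intro mult_left_mono) auto
    then have y1: "y \<le> 1" using y by simp
    have "real (Suc n) \<le> 1 / y" using y y0 by (simp add: field_simps)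
    then have "int (Suc n) \<le> \<lfloor>1 / y\<rfloor>" by (simp only: le_floor_iff of_int_of_nat_eq)
    then have "real (Suc (Suc n)) \<le> of_int (\<lfloor>1 / y\<rfloor> + 1)" by linarith
    then have "pierce_T y * real (Suc (Suc n)) \<le> pierce_T y * of_int (\<lfloor>1 / y\<rfloor> + 1)"
      using pierce_T_bounds(1)[OF y0 y1] by (rule mult_left_mono)
    then show ?thesis
      using pierce_T_bounds[OF y0 y1] by (simp add: y_def [symmetric])
  qed
qed

lemma pierce_digit_ge:
  assumes "0 \<le> x" "x \<le> 1"
  shows "enat (Suc n) \<le> pierce_digit (Suc n) x"
proof -
  define y where "y = (pierce_T ^^ n) x"
  have y: "0 \<le> y" "y * real (Suc n) \<le> 1"
    using pierce_T_funpow_bounds[OF assms, of n] by (auto simp: y_def)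
  show ?thesis
  proof (cases "y = 0")
    case True
    then show ?thesis by (simp add: pierce_digit_def pierce_d1_def y_def [symmetric])
  next
    case False
    then have "real (Suc n) \<le> 1 / y" using y by (simp add: field_simps)
    then have "int (Suc n) \<le> \<lfloor>1 / y\<rfloor>" by (simp only: le_floor_iff of_int_of_nat_eq)
    then have "Suc n \<le> nat \<lfloor>1 / y\<rfloor>" by linarith
    then show ?thesis
      using False by (simp add: pierce_digit_def pierce_d1_def y_def [symmetric])
  qed
qed

lemma conv_exp_set_gt_1:
  assumes "0 \<le> x" "x \<le> 1" "1 < s"
  shows "summable (\<lambda>n. recip_powr (pierce_digit (Suc n) x) s)"
proof (rule summable_comparison_test')
  have "summable (\<lambda>n. real n powr - s)"
    using assms by (simp add: summable_real_powr_iff)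
  then show "summable (\<lambda>n. real (Suc n) powr - s)"
    by (subst summable_Suc_iff)
  fix n :: nat
  show "norm (recip_powr (pierce_digit (Suc n) x) s) \<le> real (Suc n) powr - s"
  proof (cases "pierce_digit (Suc n) x")
    case (enat k)
    then have "Suc n \<le> k" using pierce_digit_ge[OF assms(1,2), of n] by simp
    then have "real k powr - s \<le> real (Suc n) powr - s"
      using assms by (intro powr_mono2') auto
    then show ?thesis using enat by (simp add: recip_powr_def powr_minus_divide)
  next
    case infinity
    then show ?thesis by (simp add: recip_powr_def)
  qed
qed

lemma conv_exp_in_unit_interval:
  assumes "x \<in> {0..1}"
  shows "conv_exp x \<in> {0..1}"
proof -
  let ?S = "{s. 0 < s \<and> summable (\<lambda>n. recip_powr (pierce_digit (Suc n) x) s)}"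
  have mem: "s \<in> ?S" if "1 < s" for s
    using conv_exp_set_gt_1[of x s] assms that by auto
  have bdd: "bdd_below ?S" by (rule bdd_belowI[of _ 0]) auto
  have "?S \<noteq> {}" using mem[of 2] by fastforce
  then have "0 \<le> Inf ?S" by (rule cInf_greatest) auto
  moreover have "Inf ?S \<le> 1"
  proof (rule dense_ge)
    fix s :: real assume "1 < s"
    show "Inf ?S \<le> s" by (rule cInf_lower[OF mem[OF \<open>1 < s\<close>] bdd])
  qed
  ultimately show ?thesis by (simp add: conv_exp_def)
qed

end

theory Submission
  imports Defs
begin

text \<open>Everything rests on two facts: every level set with \<open>0 \<le> \<alpha> \<le> 1\<close> is dense, and the level
  set of \<open>1\<close> is \<open>G\<^sub>\<delta>\<close>. A dense \<open>G\<^sub>\<delta>\<close> set is comeager, and by Baire's theorem the compact interval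
  does not contain two disjoint comeager sets. So the level set of \<open>1\<close> is comeager and nonmeager,
  the other level sets lie in its meager complement, and none of them is \<open>G\<^sub>\<delta>\<close>, since it would
  then be a second comeager set disjoint from the first.

  Density (\<open>conv_exp_level_dense\<close>) holds because the exponent depends only on the tail of the digit
  sequence: \<open>conv_exp (pierce_T x) = conv_exp x\<close>. If \<open>x\<close> has an infinite expansion, replace its
  \<open>n\<close>th iterate by a smaller point \<open>z > 0\<close> of exponent \<open>\<alpha>\<close> and go back along the first \<open>n\<close> digits of
  \<open>x\<close>. The resulting point has exponent \<open>\<alpha>\<close>, and its distance from \<open>x\<close> is at most \<open>1 / n!\<close>
  (\<open>pierce_replace_tail\<close>). Such \<open>z\<close> exist arbitrarily close to \<open>0\<close>, because the iterates of
  a point with infinite expansion tend to \<open>0\<close> and keep its exponent. For \<open>\<alpha> > 0\<close> the point whose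
  \<open>n\<close>th digit is \<open>\<lfloor>n powr (1 / \<alpha>)\<rfloor>\<close> has exponent \<open>\<alpha>\<close> (\<open>conv_exp_attained\<close>); for \<open>\<alpha> = 0\<close> the
  reciprocals of the positive integers serve.

  The exponent is \<open>1\<close> exactly if the digit series for each \<open>s < 1\<close> has arbitrarily large partial sums
  (\<open>gdelta_in_conv_exp_level_1\<close>). At points with infinite expansion each digit is locally constant,
  so a large partial sum is an open condition there. Finite expansions have exponent \<open>0\<close> and
  belong to rational points, so they can be cut away without leaving the class of \<open>G\<^sub>\<delta>\<close> sets.\<close>

section \<open>Meager sets and the Baire property\<close>

lemma meager_in_subset:
  assumes "meager_in X A" "B \<subseteq> A"
  shows "meager_in X B"
proof -
  obtain \<N> where \<N>: "countable \<N>" "\<forall>N\<in>\<N>. nowhere_dense_in X N" "A = \<Union>\<N>"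
    using assms(1) by (auto simp: meager_in_def)
  have "nowhere_dense_in X (N \<inter> B)" if "N \<in> \<N>" for N
  proof -
    have "X interior_of (X closure_of (N \<inter> B)) \<subseteq> X interior_of (X closure_of N)"
      by (intro interior_of_mono closure_of_mono) auto
    then show ?thesis using that \<N>(2) by (auto simp: nowhere_dense_in_def)
  qed
  moreover have "B = \<Union>((\<lambda>N. N \<inter> B) ` \<N>)" using \<N>(3) assms(2) by auto
  ultimately show ?thesis
    unfolding meager_in_def using \<N>(1) by (intro exI[of _ "(\<lambda>N. N \<inter> B) ` \<N>"]) auto
qed

lemma meager_in_Un:
  assumes "meager_in X A" "meager_in X B"
  shows "meager_in X (A \<union> B)"
proof -
  obtain \<M> \<N> where
    "countable \<M>" "\<forall>N\<in>\<M>. nowhere_dense_in X N" "A = \<Union>\<M>"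
    "countable \<N>" "\<forall>N\<in>\<N>. nowhere_dense_in X N" "B = \<Union>\<N>"
    using assms by (auto simp: meager_in_def)
  then show ?thesis
    unfolding meager_in_def by (intro exI[of _ "\<M> \<union> \<N>"]) auto
qed

lemma dense_gdelta_in_imp_comeager_in:
  assumes "dense_in X A" "gdelta_in X A"
  shows "comeager_in X A"
proof -
  obtain \<U> where \<U>: "countable \<U>" "\<And>U. U \<in> \<U> \<Longrightarrow> openin X U" "\<Inter>\<U> = A"
    using assms(2) by (auto simp: gdelta_in_alt intersection_of_def)
  have "nowhere_dense_in X (topspace X - U)" if "U \<in> \<U>" for U
  proof -
    have "X closure_of A \<subseteq> X closure_of U"
      using \<U>(3) that by (intro closure_of_mono) auto
    then have "X closure_of U = topspace X"
      using assms(1) closure_of_subset_topspace[of X U] by (auto simp: dense_in_def)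
    moreover have "X closure_of (topspace X - U) = topspace X - U"
      using \<U>(2)[OF that] by (simp add: closure_of_eq closedin_diff)
    ultimately show ?thesis
      by (simp add: nowhere_dense_in_def interior_of_complement)
  qed
  moreover have "topspace X - A = \<Union>((-) (topspace X) ` \<U>)" using \<U>(3) by auto
  ultimately have "meager_in X (topspace X - A)"
    unfolding meager_in_def using \<U>(1) by (intro exI[of _ "(-) (topspace X) ` \<U>"]) auto
  then show ?thesis using assms(1) by (auto simp: comeager_in_def dense_in_def)
qed

text \<open>Passing to closures turns a cover by nowhere dense sets into one by closed sets without
  interior, to which Baire's theorem applies.\<close>
lemma completely_metrizable_not_meager_topspace:
  assumes "completely_metrizable_space X" "topspace X \<noteq> {}"
  shows "\<not> meager_in X (topspace X)"
proof
  assume "meager_in X (topspace X)"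
  then obtain \<N> where \<N>: "countable \<N>" "\<And>N. N \<in> \<N> \<Longrightarrow> nowhere_dense_in X N"
      "topspace X = \<Union>\<N>"
    by (auto simp: meager_in_def)
  have "X interior_of \<Union>((closure_of) X ` \<N>) = {}"
    using assms(1) \<N> by (intro Baire_category_alt) (auto simp: nowhere_dense_in_def)
  moreover have "\<Union>((closure_of) X ` \<N>) = topspace X"
  proof
    show "\<Union>((closure_of) X ` \<N>) \<subseteq> topspace X"
      by (intro UN_least closure_of_subset_topspace)
    have "N \<subseteq> X closure_of N" if "N \<in> \<N>" for N
      using \<N>(2)[OF that] by (intro closure_of_subset) (simp add: nowhere_dense_in_def)
    then show "topspace X \<subseteq> \<Union>((closure_of) X ` \<N>)" unfolding \<N>(3) by blast
  qed
  ultimately show False using assms(2) by simp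
qed

lemma disjoint_comeager_in_imp_False:
  assumes "completely_metrizable_space X" "topspace X \<noteq> {}"
    and "comeager_in X A" "comeager_in X B" "A \<inter> B = {}"
  shows False
proof -
  have "meager_in X ((topspace X - A) \<union> (topspace X - B))"
    using assms(3,4) by (intro meager_in_Un) (auto simp: comeager_in_def)
  moreover have "(topspace X - A) \<union> (topspace X - B) = topspace X" using assms(5) by auto
  ultimately show False using completely_metrizable_not_meager_topspace[OF assms(1,2)] by simp
qed


section \<open>The convergence exponent\<close>

lemma conv_exp_eqI:
  assumes "0 \<le> a"
    and "\<And>s. a < s \<Longrightarrow> summable (\<lambda>n. recip_powr (pierce_digit (Suc n) x) s)"
    and "\<And>s. 0 < s \<Longrightarrow> s < a \<Longrightarrow> \<not> summable (\<lambda>n. recip_powr (pierce_digit (Suc n) x) s)"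
  shows "conv_exp x = a"
  unfolding conv_exp_def
proof (rule cInf_eq)
  fix s assume "s \<in> {s. 0 < s \<and> summable (\<lambda>n. recip_powr (pierce_digit (Suc n) x) s)}"
  then show "a \<le> s" using assms(3)[of s] by force
next
  fix y
  assume y: "\<And>s. s \<in> {s. 0 < s \<and> summable (\<lambda>n. recip_powr (pierce_digit (Suc n) x) s)} \<Longrightarrow> y \<le> s"
  show "y \<le> a"
    by (rule dense_ge) (use assms(1,2) y in auto)
qed

lemma conv_exp_eq_1_iff:
  assumes "x \<in> {0..1}"
  shows "conv_exp x = 1 \<longleftrightarrow>
    (\<forall>s. 0 < s \<and> s < 1 \<longrightarrow> \<not> summable (\<lambda>n. recip_powr (pierce_digit (Suc n) x) s))"
proof (intro iffI allI impI notI)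
  fix s assume "conv_exp x = 1" "0 < s \<and> s < 1"
    and "summable (\<lambda>n. recip_powr (pierce_digit (Suc n) x) s)"
  moreover from this have "conv_exp x \<le> s"
    unfolding conv_exp_def by (intro cInf_lower bdd_belowI[of _ 0]) auto
  ultimately show False by simp
next
  assume "\<forall>s. 0 < s \<and> s < 1 \<longrightarrow> \<not> summable (\<lambda>n. recip_powr (pierce_digit (Suc n) x) s)"
  then show "conv_exp x = 1"
    using assms conv_exp_set_gt_1[of x] by (intro conv_exp_eqI) auto
qed

lemma pierce_digit_Suc_Suc: "pierce_digit (Suc (Suc n)) x = pierce_digit (Suc n) (pierce_T x)"
  by (simp add: pierce_digit_def funpow_swap1)

lemma conv_exp_pierce_T: "conv_exp (pierce_T x) = conv_exp x"
proof -
  have "summable (\<lambda>n. recip_powr (pierce_digit (Suc n) (pierce_T x)) s) \<longleftrightarrow>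
        summable (\<lambda>n. recip_powr (pierce_digit (Suc n) x) s)" for s
    using summable_Suc_iff[of "\<lambda>n. recip_powr (pierce_digit (Suc n) x) s"]
    by (simp add: pierce_digit_Suc_Suc)
  then show ?thesis by (simp add: conv_exp_def)
qed

text \<open>Convergence of a series does not depend on its first terms.\<close>
lemma conv_exp_pierce_T_funpow: "conv_exp ((pierce_T ^^ n) x) = conv_exp x"
  by (induction n) (simp_all add: conv_exp_pierce_T)

lemma conv_exp_0: "conv_exp 0 = 0"
proof (rule conv_exp_eqI)
  have "(pierce_T ^^ n) 0 = 0" for n by (induction n) (simp_all add: pierce_T_def)
  then show "summable (\<lambda>n. recip_powr (pierce_digit (Suc n) 0) s)" for s
    by (simp add: pierce_digit_def pierce_d1_def recip_powr_def)
qed simp_all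

lemma recip_powr_nonneg: "0 \<le> recip_powr d s"
  by (simp add: recip_powr_def split: enat.split)

lemma recip_powr_antimono:
  assumes "s \<le> t"
  shows "recip_powr d t \<le> recip_powr d s"
proof (cases d)
  case (enat k)
  show ?thesis
  proof (cases "k = 0")
    case False
    then have "real k powr s \<le> real k powr t" using assms by (intro powr_mono) auto
    then show ?thesis using False enat by (simp add: recip_powr_def frac_le)
  qed (simp add: enat recip_powr_def)
qed (simp add: recip_powr_def)

lemma summable_recip_powr_mono:
  assumes "summable (\<lambda>n. recip_powr (d n) s)" "s \<le> t"
  shows "summable (\<lambda>n. recip_powr (d n) t)"
  by (rule summable_comparison_test'[OF assms(1)])
    (use recip_powr_antimono[OF assms(2)] in \<open>simp add: recip_powr_nonneg\<close>)


section \<open>Infinite expansions and inverse branches\<close>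

text \<open>These are the irrational points of the unit interval. In terms of the orbit, the
  condition says that no digit is \<open>\<infinity>\<close>.\<close>
definition pierce_infinite :: "real set" where
  "pierce_infinite = {x \<in> {0..1}. \<forall>n. (pierce_T ^^ n) x \<noteq> 0}"

lemma pierce_infiniteD:
  assumes "x \<in> pierce_infinite"
  shows "0 < (pierce_T ^^ n) x" "(pierce_T ^^ n) x \<le> 1" "(pierce_T ^^ n) x * real (Suc n) \<le> 1"
    and "pierce_T ((pierce_T ^^ n) x) \<noteq> 0"
proof -
  note b = pierce_T_funpow_bounds[of x n]
  show 0: "0 < (pierce_T ^^ n) x" and 1: "(pierce_T ^^ n) x * real (Suc n) \<le> 1"
    using assms b by (auto simp: pierce_infinite_def order_less_le)
  have "(pierce_T ^^ n) x * 1 \<le> (pierce_T ^^ n) x * real (Suc n)"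
    using 0 by (intro mult_left_mono) auto
  with 1 show "(pierce_T ^^ n) x \<le> 1" by linarith
  have "(pierce_T ^^ Suc n) x \<noteq> 0" using assms unfolding pierce_infinite_def by blast
  then show "pierce_T ((pierce_T ^^ n) x) \<noteq> 0" by simp
qed

text \<open>A point is recovered from its image by \<open>x = (1 - pierce_T x) / \<lfloor>1 / x\<rfloor>\<close>, which preserves
  rationality.\<close>
lemma rational_if_pierce_terminates:
  assumes "x \<in> {0..1}" "(pierce_T ^^ n) x = 0"
  shows "x \<in> \<rat>"
  using assms
proof (induction n arbitrary: x)
  case (Suc n)
  show ?case
  proof (cases "x = 0")
    case False
    then have x: "0 < x" "x \<le> 1" using Suc.prems by auto
    have "1 \<le> \<lfloor>1 / x\<rfloor>" using x by (simp add: le_floor_iff)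
    then have k: "\<lfloor>1 / x\<rfloor> \<noteq> 0" by linarith
    have "pierce_T x \<in> \<rat>"
      using Suc pierce_T_bounds[OF x] x by (simp add: funpow_swap1)
    moreover have "x = (1 - pierce_T x) / of_int \<lfloor>1 / x\<rfloor>"
      using False k by (simp add: pierce_T_def)
    ultimately show ?thesis
      by (metis Rats_1 Rats_diff Rats_divide Rats_of_int)
  qed simp
qed simp

lemma pierce_finite_countable: "countable ({0..1} - pierce_infinite)"
proof (rule countable_subset)
  show "{0..1} - pierce_infinite \<subseteq> \<rat>"
    using rational_if_pierce_terminates by (auto simp: pierce_infinite_def)
qed (rule countable_rat)

lemma pierce_finite_conv_exp:
  assumes "x \<in> {0..1}" "x \<notin> pierce_infinite"
  shows "conv_exp x = 0"
proof -
  obtain n where "(pierce_T ^^ n) x = 0" using assms by (auto simp: pierce_infinite_def)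
  then show ?thesis using conv_exp_pierce_T_funpow[of n x] conv_exp_0 by simp
qed

text \<open>The graph of \<open>pierce_T\<close> over the points of first digit \<open>k\<close> is a line of slope \<open>-k\<close>
  whose heights fill \<open>[0, 1 / (k + 1))\<close>; this is its inverse.\<close>
lemma pierce_inverse_branch:
  assumes "1 \<le> k" "0 \<le> z" "z * (of_int k + 1) < 1"
  shows "0 < (1 - z) / of_int k" "(1 - z) / of_int k \<le> 1"
    and "\<lfloor>1 / ((1 - z) / of_int k)\<rfloor> = k" "pierce_T ((1 - z) / of_int k) = z"
proof -
  have "z * 1 \<le> z * (of_int k + 1)" using assms by (intro mult_left_mono) auto
  then have z: "z < 1" using assms by linarith
  then show pos: "0 < (1 - z) / of_int k" using assms by simp
  show "(1 - z) / of_int k \<le> 1" using assms by (simp add: field_simps)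
  have "of_int k \<le> of_int k / (1 - z)" "of_int k / (1 - z) < of_int k + 1"
    using assms z by (auto simp: field_simps)
  then show fl: "\<lfloor>1 / ((1 - z) / of_int k)\<rfloor> = k" by (simp add: floor_eq_iff)
  show "pierce_T ((1 - z) / of_int k) = z"
    unfolding pierce_T_def fl using pos assms(1) by auto
qed

text \<open>Run the inverse branches backwards along the first \<open>n\<close> digits of \<open>x\<close>. The \<open>i\<close>th digit is at
  least \<open>i\<close>, so the \<open>i\<close>th branch contracts distances by a factor of at least \<open>i\<close>.

  The hypothesis \<open>z < 1 / k\<close>, with \<open>k\<close> the digit of \<open>x\<close> after the \<open>n\<close>th, is what the induction
  reproduces: if \<open>l\<close> is the preceding digit, then \<open>l + 1 \<le> k\<close>, so \<open>z\<close> lies in the domain of the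
  inverse branch of \<open>l\<close>, and \<open>z > 0\<close> gives \<open>(1 - z) / l < 1 / l\<close>. For \<open>z = 0\<close> the preimage would be \<open>1 / l\<close>,
  which is outside the domain of the next branch if the digit before \<open>l\<close> is \<open>l - 1\<close>.\<close>
lemma pierce_replace_tail:
  assumes "x \<in> pierce_infinite" "0 < z" "z * of_int \<lfloor>1 / (pierce_T ^^ n) x\<rfloor> < 1"
  shows "\<exists>x'\<in>{0..1}. (pierce_T ^^ n) x' = z \<and> \<bar>x' - x\<bar> * fact n \<le> \<bar>z - (pierce_T ^^ n) x\<bar>"
  using assms(2,3)
proof (induction n arbitrary: z)
  case 0
  have "1 \<le> \<lfloor>1 / x\<rfloor>" using pierce_infiniteD(1,2)[OF assms(1), of 0] by (simp add: le_floor_iff)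
  then have "1 \<le> real_of_int \<lfloor>1 / x\<rfloor>" by linarith
  then have "z * 1 \<le> z * of_int \<lfloor>1 / x\<rfloor>" using 0 by (intro mult_left_mono) auto
  moreover have "z * of_int \<lfloor>1 / x\<rfloor> < 1" using 0 by simp
  ultimately have "z \<le> 1" by linarith
  then show ?case using 0 by (intro bexI[of _ z]) auto
next
  case (Suc n)
  define y where "y = (pierce_T ^^ n) x"
  define k where "k = \<lfloor>1 / y\<rfloor>"
  define w where "w = (1 - z) / of_int k"
  have y: "0 < y" "y \<le> 1" "y * real (Suc n) \<le> 1" "pierce_T y \<noteq> 0"
    using pierce_infiniteD[OF assms(1), of n] by (simp_all add: y_def)
  have kn: "int (Suc n) \<le> k"
    unfolding k_def le_floor_iff using y by (simp add: field_simps)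
  have Ty: "0 < pierce_T y" "pierce_T y * of_int (k + 1) < 1"
    using pierce_T_bounds[OF y(1,2)] y(4) by (auto simp: k_def)
  then have "k + 1 \<le> \<lfloor>1 / pierce_T y\<rfloor>"
    unfolding le_floor_iff by (simp add: field_simps)
  then have "z * of_int (k + 1) \<le> z * of_int \<lfloor>1 / pierce_T y\<rfloor>"
    using Suc.prems by (intro mult_left_mono) auto
  moreover have "z * of_int \<lfloor>1 / pierce_T y\<rfloor> < 1" using Suc.prems by (simp add: y_def)
  ultimately have z: "z * (of_int k + 1) < 1" by simp
  have w: "0 < w" "pierce_T w = z"
    using pierce_inverse_branch[of k z] kn Suc.prems z by (auto simp: w_def)
  have wk: "w * of_int k = 1 - z" using kn by (simp add: w_def)
  obtain x' where x': "x' \<in> {0..1}" "(pierce_T ^^ n) x' = w" "\<bar>x' - x\<bar> * fact n \<le> \<bar>w - y\<bar>"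
    using Suc.IH[of w] w wk Suc.prems by (auto simp: y_def k_def)
  have "\<bar>x' - x\<bar> * fact (Suc n) = \<bar>x' - x\<bar> * fact n * real (Suc n)"
    by (simp add: algebra_simps)
  also have "\<dots> \<le> \<bar>w - y\<bar> * of_int k"
    using x'(3) kn by (intro mult_mono) auto
  also have "\<dots> = \<bar>(w - y) * of_int k\<bar>"
    using kn by (simp add: abs_mult)
  also have "\<dots> = \<bar>w * of_int k - of_int k * y\<bar>"
    by (simp add: algebra_simps)
  also have "\<dots> = \<bar>z - pierce_T y\<bar>"
  proof -
    have "w * of_int k - of_int k * y = - (z - pierce_T y)"
      unfolding wk using y(1) by (simp add: pierce_T_def k_def)
    then show ?thesis by (simp only: abs_minus_cancel)
  qed
  finally show ?case
    using x'(1,2) w(2) by (intro bexI[of _ x']) (auto simp: y_def)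
qed


section \<open>Density of the level sets\<close>

text \<open>The digits of the approximating point after the \<open>n\<close>th are those of \<open>z\<close>, so it has the
  exponent of \<open>z\<close>, while its distance from \<open>x\<close> is at most \<open>1 / n!\<close>.\<close>
lemma pierce_infinite_subset_closure:
  assumes small: "\<And>e. 0 < e \<Longrightarrow> \<exists>z. 0 < z \<and> z < e \<and> conv_exp z = a"
    and x: "x \<in> pierce_infinite"
  shows "x \<in> closure (conv_exp_level a)"
  unfolding closure_approachable
proof (intro allI impI)
  fix e :: real assume e: "0 < e"
  have "(\<lambda>n. inverse (fact n :: real)) \<longlonglongrightarrow> 0"
    using summable_exp[of "1 :: real"] by (auto dest: summable_LIMSEQ_zero)
  then have "eventually (\<lambda>n. inverse (fact n :: real) < e) sequentially"
    using e by (rule order_tendstoD)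
  then obtain n where n: "inverse (fact n :: real) < e"
    by (auto simp: eventually_sequentially)
  define y where "y = (pierce_T ^^ n) x"
  have y: "0 < y" "y \<le> 1" using pierce_infiniteD[OF x, of n] by (auto simp: y_def)
  obtain z where z: "0 < z" "z < y" "conv_exp z = a" using small[OF y(1)] by blast
  have "z * of_int \<lfloor>1 / y\<rfloor> \<le> z * (1 / y)" using z by (intro mult_left_mono) auto
  also have "\<dots> < 1" using y z by simp
  finally obtain x' where x': "x' \<in> {0..1}" "(pierce_T ^^ n) x' = z" "\<bar>x' - x\<bar> * fact n \<le> \<bar>z - y\<bar>"
    using pierce_replace_tail[OF x z(1), of n] by (auto simp: y_def)
  have "\<bar>x' - x\<bar> * fact n \<le> 1" using x'(3) y z by linarith
  then have "\<bar>x' - x\<bar> \<le> inverse (fact n)" by (simp add: field_simps)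
  with n have "dist x' x < e" by (simp add: dist_real_def)
  moreover have "x' \<in> conv_exp_level a"
    using x' z(3) conv_exp_pierce_T_funpow[of n x'] by (simp add: conv_exp_level_def)
  ultimately show "\<exists>x'\<in>conv_exp_level a. dist x' x < e" by blast
qed

text \<open>A countable set fills no interval, so the points with infinite expansion are dense.\<close>
lemma conv_exp_level_dense:
  assumes "\<And>e. 0 < e \<Longrightarrow> \<exists>z. 0 < z \<and> z < e \<and> conv_exp z = a"
  shows "dense_in (top_of_set {0..1}) (conv_exp_level a)"
proof -
  let ?L = "conv_exp_level a"
  have "{0<..<1} \<subseteq> closure ?L"
  proof
    fix x :: real assume x: "x \<in> {0<..<1}"
    show "x \<in> closure ?L"
      unfolding closure_iff_nhds_not_empty
    proof (intro allI impI)
      fix A V assume AV: "V \<subseteq> A" "open V" "x \<in> V"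
      have "open (V \<inter> {0<..<1})" "V \<inter> {0<..<1} \<noteq> {}" using AV x by auto
      then obtain p where "p \<in> V" "p \<in> pierce_infinite"
        using open_minus_countable[OF pierce_finite_countable, of "V \<inter> {0<..<1}"] by force
      then have "p \<in> V \<inter> closure ?L"
        using pierce_infinite_subset_closure[OF assms] by blast
      then have "V \<inter> ?L \<noteq> {}" using open_Int_closure_eq_empty[OF AV(2)] by blast
      then show "?L \<inter> A \<noteq> {}" using AV(1) by blast
    qed
  qed
  then have "closure {0<..<1} \<subseteq> closure ?L" by (rule closure_minimal) simp
  then have "{0..1} \<subseteq> closure ?L" by (simp add: closure_greaterThanLessThan)
  moreover have "?L \<subseteq> {0..1}" by (auto simp: conv_exp_level_def)
  ultimately show ?thesis
    by (auto simp: dense_in_def closure_of_subtopology Int_absorb1)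
qed

text \<open>The point is the alternating Pierce series of \<open>d\<close>. Every term contains the factor
  \<open>1 / d 0\<close>, and taking it out relates the sum to that of the shifted sequence by the inverse
  branch of \<open>d 0\<close>.\<close>
lemma pierce_expansion_exists:
  fixes d :: "nat \<Rightarrow> nat"
  assumes "strict_mono d" "1 \<le> d 0"
  shows "\<exists>x\<in>{0<..1}. \<forall>n. pierce_digit (Suc n) x = enat (d n) \<and> 0 < (pierce_T ^^ n) x"
proof -
  define c where "c m k = 1 / (\<Prod>i\<le>k. real (d (m + i)))" for m k
  define X where "X m = (\<Sum>k. (-1) ^ k * c m k)" for m
  have d_less: "d m < d (Suc m)" for m using assms(1) by (simp add: strict_mono_Suc_iff)
  have d_ge: "Suc m \<le> d m" for m
    by (induction m) (use assms(2) d_less in \<open>auto intro: less_le_trans Suc_leI le_less_trans\<close>)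
  have d1: "1 \<le> real (d m)" for m using d_ge[of m] by simp
  have d0: "0 < real (d m)" for m using d1[of m] by linarith
  have c_pos: "0 < c m k" for m k unfolding c_def using d0 by (simp add: prod_pos)
  have c_Suc: "c m (Suc k) = c m k / real (d (m + Suc k))" for m k
    by (simp add: c_def)
  have c_shift: "c m (Suc k) = c (Suc m) k / real (d m)" for m k
    unfolding c_def by (subst prod.atMost_Suc_shift) simp
  have c_dec: "c m (Suc k) \<le> c m k" for m k
    using c_pos[of m k] d1[of "m + Suc k"]
    by (simp only: c_Suc) (simp add: divide_le_eq mult_le_cancel_left1)
  have c_le: "c m k \<le> 1 / real (Suc k)" for m k
  proof (cases k)
    case 0
    then show ?thesis using d1[of m] by (simp add: c_def)
  next
    case (Suc j)
    have "c m k \<le> c m 0" for k by (induction k) (auto intro: order_trans[OF c_dec])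
    moreover have "c m 0 \<le> 1" using d1[of m] by (simp add: c_def)
    ultimately have "c m j \<le> 1" using order_trans by blast
    moreover have "real (Suc k) \<le> real (d (m + k))" using d_ge[of "m + k"] by simp
    ultimately show ?thesis unfolding Suc c_Suc using c_pos[of m j]
      by (intro frac_le) auto
  qed
  have c_lim: "c m \<longlonglongrightarrow> 0" for m
  proof (rule tendsto_sandwich[OF _ _ tendsto_const])
    show "(\<lambda>k. 1 / real (Suc k)) \<longlonglongrightarrow> 0" by (rule lim_1_over_n[THEN LIMSEQ_Suc])
  qed (auto intro!: always_eventually less_imp_le[OF c_pos] simp: c_le simp del: of_nat_Suc)
  note leibniz = summable_Leibniz'[OF c_lim less_imp_le[OF c_pos] c_dec]
  have X_bounds: "0 \<le> X m" "X m \<le> 1 / real (d m)" for m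
    using leibniz(2)[of m 0] leibniz(4)[of m 0] by (simp_all add: X_def c_def)
  have X_rec: "X m = (1 - X (Suc m)) / real (d m)" for m
  proof -
    have "(\<Sum>k. (-1) ^ Suc k * c m (Suc k)) = X m - (-1) ^ 0 * c m 0"
      using suminf_split_head[OF leibniz(1)[of m]] by (simp add: X_def)
    moreover have "(-1) ^ Suc k * c m (Suc k) = ((-1) ^ k * c (Suc m) k) * (- 1 / real (d m))" for k
      by (simp add: c_shift)
    then have "(\<Sum>k. (-1) ^ Suc k * c m (Suc k)) = X (Suc m) * (- 1 / real (d m))"
      unfolding X_def by (simp only: suminf_mult2[OF leibniz(1)])
    ultimately have "X m = 1 / real (d m) + X (Suc m) * (- 1 / real (d m))" by (simp add: c_def)
    then show ?thesis by (simp add: diff_divide_distrib)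
  qed
  have X_pos: "0 < X m" for m
  proof -
    have "2 \<le> d (Suc m)" using d_ge[of "Suc m"] by simp
    then have "1 / real (d (Suc m)) < 1" by simp
    then have "X (Suc m) < 1" using X_bounds(2)[of "Suc m"] by linarith
    then show ?thesis using d0[of m] by (subst X_rec) simp
  qed
  have step: "X m \<le> 1" "\<lfloor>1 / X m\<rfloor> = int (d m)" "pierce_T (X m) = X (Suc m)" for m
  proof -
    have "X (Suc m) * (real (d m) + 1) \<le> X (Suc m) * real (d (Suc m))"
      using d_less[of m] X_pos[of "Suc m"] by (intro mult_left_mono) auto
    also have "\<dots> = 1 - X (Suc (Suc m))"
      using d0[of "Suc m"] by (subst X_rec) simp
    also have "\<dots> < 1" using X_pos by simp
    finally have "X (Suc m) * (of_int (int (d m)) + 1) < 1" by simp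
    then show "X m \<le> 1" "\<lfloor>1 / X m\<rfloor> = int (d m)" "pierce_T (X m) = X (Suc m)"
      using pierce_inverse_branch[of "int (d m)" "X (Suc m)"] d_ge[of m] X_pos[of "Suc m"]
      by (auto simp: X_rec[of m, symmetric])
  qed
  have "(pierce_T ^^ n) (X 0) = X n" for n by (induction n) (simp_all add: step)
  then show ?thesis
    using X_pos step
    by (intro bexI[of _ "X 0"]) (auto simp: pierce_digit_def pierce_d1_def less_imp_neq[THEN not_sym])
qed

text \<open>The digits \<open>\<lfloor>n powr (1 / a)\<rfloor>\<close> for \<open>n = 1, 2, \<dots>\<close> differ from \<open>n powr (1 / a)\<close> by a bounded factor,
  so that the sum for \<open>s\<close> converges exactly when \<open>s / a > 1\<close>. They strictly increase since
  \<open>1 / a \<ge> 1\<close>.\<close>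
lemma conv_exp_attained:
  assumes "0 < a" "a \<le> 1"
  shows "\<exists>x\<in>{0<..1}. (\<forall>n. 0 < (pierce_T ^^ n) x) \<and> conv_exp x = a"
proof -
  define p where "p = 1 / a"
  have p: "1 \<le> p" using assms by (simp add: p_def)
  define u where "u n = real (Suc n) powr p" for n
  define d where "d n = nat \<lfloor>u n\<rfloor>" for n
  have u1: "1 \<le> u n" for n using p by (simp add: u_def ge_one_powr_ge_zero)
  have u_Suc: "u n + 1 \<le> u (Suc n)" for n
  proof -
    \<comment> \<open>\<open>(n + 2) * (n + 2) powr (p - 1)\<close> is at least \<open>(n + 2) * (n + 1) powr (p - 1)\<close>, which is
      \<open>(n + 1) powr p\<close> plus a term that is at least \<open>1\<close>.\<close>
    have "real (Suc n) powr (p - 1) \<le> real (Suc (Suc n)) powr (p - 1)"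
      using p by (intro powr_mono2) auto
    then have "real (Suc (Suc n)) * real (Suc n) powr (p - 1) \<le>
        real (Suc (Suc n)) * real (Suc (Suc n)) powr (p - 1)"
      by (intro mult_left_mono) auto
    also have "\<dots> = u (Suc n)" by (simp add: u_def powr_mult_base)
    finally have "real (Suc n) * real (Suc n) powr (p - 1) + real (Suc n) powr (p - 1) \<le> u (Suc n)"
      by (simp add: algebra_simps)
    moreover have "real (Suc n) * real (Suc n) powr (p - 1) = u n"
      using powr_mult_base[of "real (Suc n)" "p - 1"] by (simp add: u_def)
    moreover have "1 \<le> real (Suc n) powr (p - 1)" using p by (intro ge_one_powr_ge_zero) auto
    ultimately show ?thesis by linarith
  qed
  have rd: "real (d n) = of_int \<lfloor>u n\<rfloor>" for n using u1[of n] by (simp add: d_def)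
  have d_u: "real (d n) \<le> u n" "u n \<le> 2 * real (d n)" for n
  proof -
    show "real (d n) \<le> u n" unfolding rd by simp
    have "1 \<le> \<lfloor>u n\<rfloor>" using u1[of n] by (simp add: le_floor_iff)
    then show "u n \<le> 2 * real (d n)" unfolding rd by linarith
  qed
  have d1: "1 \<le> d n" for n using u1[of n] by (simp add: d_def le_nat_iff le_floor_iff)
  have "strict_mono d"
    unfolding strict_mono_Suc_iff
  proof
    fix n
    have "\<lfloor>u n\<rfloor> + 1 \<le> \<lfloor>u (Suc n)\<rfloor>" using u_Suc[of n] by linarith
    then have "real (d n) + 1 \<le> real (d (Suc n))" unfolding rd by linarith
    then show "d n < d (Suc n)" by linarith
  qed
  then obtain x where x: "x \<in> {0<..1}" "\<And>n. pierce_digit (Suc n) x = enat (d n)"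
      "\<And>n. 0 < (pierce_T ^^ n) x"
    using pierce_expansion_exists[of d] d1 by blast
  have r: "recip_powr (pierce_digit (Suc n) x) s = real (d n) powr - s" for n s
    by (simp add: x(2) recip_powr_def powr_minus_divide)
  have u_powr: "u n powr - s = real (Suc n) powr (- s / a)" for n s
    by (simp add: u_def powr_powr p_def)
  have summ: "summable (\<lambda>n. u n powr - s) \<longleftrightarrow> a < s" for s
  proof -
    have "summable (\<lambda>n. u n powr - s) \<longleftrightarrow> summable (\<lambda>n. real n powr (- s / a))"
      unfolding u_powr by (rule summable_Suc_iff)
    then show ?thesis using assms by (simp add: summable_real_powr_iff field_simps)
  qed
  have "conv_exp x = a"
  proof (rule conv_exp_eqI)
    fix s assume s: "a < s"
    have "summable (\<lambda>n. 2 powr s * u n powr - s)" using s summ by (intro summable_mult) simp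
    then show "summable (\<lambda>n. recip_powr (pierce_digit (Suc n) x) s)"
    proof (rule summable_comparison_test')
      fix n :: nat
      have "(2 * real (d n)) powr - s \<le> u n powr - s"
        using d_u[of n] u1[of n] s assms by (intro powr_mono2') auto
      then have "2 powr s * (2 * real (d n)) powr - s \<le> 2 powr s * u n powr - s"
        by (intro mult_left_mono) auto
      moreover have "2 powr s * (2 * real (d n)) powr - s = real (d n) powr - s"
        by (simp add: powr_mult powr_minus)
      ultimately show "norm (recip_powr (pierce_digit (Suc n) x) s) \<le> 2 powr s * u n powr - s"
        by (simp add: r)
    qed
  next
    fix s assume s: "0 < s" "s < a"
    show "\<not> summable (\<lambda>n. recip_powr (pierce_digit (Suc n) x) s)"
    proof
      assume "summable (\<lambda>n. recip_powr (pierce_digit (Suc n) x) s)"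
      then have "summable (\<lambda>n. u n powr - s)"
      proof (rule summable_comparison_test')
        fix n :: nat
        have "u n powr - s \<le> real (d n) powr - s"
          using d_u[of n] d1[of n] s by (intro powr_mono2') auto
        then show "norm (u n powr - s) \<le> recip_powr (pierce_digit (Suc n) x) s" by (simp add: r)
      qed
      then show False using s summ by simp
    qed
  qed (use assms in simp)
  then show ?thesis using x by blast
qed

text \<open>Small points come from the orbit of a single point of the level set, since
  \<open>(pierce_T ^^ n) x \<le> 1 / (n + 1)\<close>. At level \<open>0\<close> the reciprocals of integers serve.\<close>
lemma conv_exp_attained_near_0:
  assumes "0 \<le> a" "a \<le> 1" "0 < e"
  shows "\<exists>z. 0 < z \<and> z < e \<and> conv_exp z = a"
proof -
  obtain n where n: "inverse (real (Suc n)) < e" using reals_Archimedean[OF assms(3)] by blast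
  show ?thesis
  proof (cases "a = 0")
    case True
    have "pierce_T (inverse (real (Suc n))) = 0"
      using pierce_inverse_branch(4)[of "int (Suc n)" 0] by (simp add: field_simps)
    then have "conv_exp (inverse (real (Suc n))) = a"
      using conv_exp_pierce_T[of "inverse (real (Suc n))"] by (simp add: True conv_exp_0)
    then show ?thesis using n by (intro exI[of _ "inverse (real (Suc n))"]) auto
  next
    case False
    then obtain x where x: "x \<in> {0<..1}" "\<And>n. 0 < (pierce_T ^^ n) x" "conv_exp x = a"
      using conv_exp_attained[of a] assms by auto
    have "(pierce_T ^^ n) x * real (Suc n) \<le> 1" using pierce_T_funpow_bounds[of x n] x(1) by simp
    then have "(pierce_T ^^ n) x \<le> inverse (real (Suc n))" by (simp add: field_simps)
    then show ?thesis
      using n x by (intro exI[of _ "(pierce_T ^^ n) x"]) (simp add: conv_exp_pierce_T_funpow)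
  qed
qed


section \<open>The top level set is a countable intersection of open sets\<close>

text \<open>The first digit jumps only where \<open>1 / x\<close> is an integer, and there \<open>pierce_T x = 0\<close>.\<close>
lemma eventually_pierce_floor_eq:
  assumes "0 < x" "pierce_T x \<noteq> 0"
  shows "eventually (\<lambda>y. y \<noteq> 0 \<and> \<lfloor>1 / y\<rfloor> = \<lfloor>1 / x\<rfloor>) (nhds x)"
proof (rule eventually_conj)
  show "eventually (\<lambda>y. y \<noteq> 0) (nhds x)" using assms(1) by (intro t1_space_nhds) simp
  have "1 / x \<notin> \<int>"
  proof
    assume "1 / x \<in> \<int>"
    then have "of_int \<lfloor>1 / x\<rfloor> = 1 / x" by (rule of_int_floor)
    then have "of_int \<lfloor>1 / x\<rfloor> * x = 1" using assms(1) by (simp only:) simp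
    then show False using assms by (simp add: pierce_T_def)
  qed
  moreover have "((\<lambda>y. 1 / y) \<longlongrightarrow> 1 / x) (nhds x)"
    unfolding tendsto_at_iff_tendsto_nhds[symmetric] using assms(1) by (intro tendsto_intros) auto
  ultimately show "eventually (\<lambda>y. \<lfloor>1 / y\<rfloor> = \<lfloor>1 / x\<rfloor>) (nhds x)"
    by (intro eventually_floor_eq)
qed

lemma isCont_pierce_T:
  assumes "0 < x" "pierce_T x \<noteq> 0"
  shows "isCont pierce_T x"
proof -
  have "eventually (\<lambda>y. pierce_T y = 1 - of_int \<lfloor>1 / x\<rfloor> * y) (nhds x)"
    using eventually_pierce_floor_eq[OF assms] by eventually_elim (simp add: pierce_T_def)
  then have "isCont pierce_T x \<longleftrightarrow> isCont (\<lambda>y. 1 - of_int \<lfloor>1 / x\<rfloor> * y) x" by (rule isCont_cong)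
  then show ?thesis by simp
qed

lemma isCont_pierce_T_funpow:
  assumes "x \<in> pierce_infinite"
  shows "isCont (pierce_T ^^ n) x"
proof (induction n)
  case 0
  show ?case by (simp add: id_def)
next
  case (Suc n)
  have "isCont pierce_T ((pierce_T ^^ n) x)"
    using pierce_infiniteD[OF assms, of n] by (intro isCont_pierce_T)
  with Suc have "isCont (\<lambda>y. pierce_T ((pierce_T ^^ n) y)) x" by (rule isCont_o2)
  then show ?case by (simp add: o_def)
qed

lemma eventually_pierce_digit_eq:
  assumes "x \<in> pierce_infinite"
  shows "eventually (\<lambda>y. pierce_digit (Suc n) y = pierce_digit (Suc n) x) (nhds x)"
proof -
  define z where "z = (pierce_T ^^ n) x"
  have z: "0 < z" "pierce_T z \<noteq> 0" using pierce_infiniteD[OF assms, of n] by (auto simp: z_def)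
  have "filterlim (pierce_T ^^ n) (nhds z) (nhds x)"
    using isCont_pierce_T_funpow[OF assms, of n]
    by (simp add: z_def isCont_def tendsto_at_iff_tendsto_nhds)
  with eventually_pierce_floor_eq[OF z]
  have "eventually (\<lambda>y. (pierce_T ^^ n) y \<noteq> 0 \<and> \<lfloor>1 / (pierce_T ^^ n) y\<rfloor> = \<lfloor>1 / z\<rfloor>) (nhds x)"
    by (rule eventually_compose_filterlim)
  then show ?thesis
    by eventually_elim (use z(1) in \<open>simp add: pierce_digit_def pierce_d1_def z_def[symmetric]\<close>)
qed

lemma gdelta_in_pierce_infinite: "gdelta_in (top_of_set {0..1}) pierce_infinite"
proof -
  let ?X = "top_of_set {0..1::real}"
  let ?Q = "{0..1} - pierce_infinite"
  have "closedin ?X {q}" if "q \<in> ?Q" for q using that by simp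
  then have "fsigma_in ?X (\<Union>((\<lambda>q. {q}) ` ?Q))"
    using pierce_finite_countable by (intro fsigma_in_Union) (auto intro: closed_imp_fsigma_in)
  then have "fsigma_in ?X ?Q" by simp
  then have "gdelta_in ?X (topspace ?X - ?Q)" by (intro gdelta_in_diff gdelta_in_topspace)
  moreover have "topspace ?X - ?Q = pierce_infinite" by (auto simp: pierce_infinite_def)
  ultimately show ?thesis by simp
qed

lemma not_summable_nonneg_iff:
  fixes f :: "nat \<Rightarrow> real"
  assumes "\<And>n. 0 \<le> f n"
  shows "\<not> summable f \<longleftrightarrow> (\<forall>M::nat. \<exists>N. real M < sum f {..<N})"
proof
  assume "\<not> summable f"
  then show "\<forall>M::nat. \<exists>N. real M < sum f {..<N}"
    using summableI_nonneg_bounded[of f] assms by (meson not_less)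
next
  assume *: "\<forall>M::nat. \<exists>N. real M < sum f {..<N}"
  show "\<not> summable f"
  proof
    assume "summable f"
    then have "sum f {..<N} \<le> suminf f" for N using assms by (intro sum_le_suminf) auto
    moreover obtain M :: nat where "suminf f \<le> real M" using real_arch_simple by blast
    ultimately show False using * by (meson not_less order_trans)
  qed
qed

text \<open>\<open>G m M\<close> need not be open, because digits jump at points with finite expansion. At points with
  infinite expansion finitely many digits are locally constant, so such a point of \<open>G m M\<close> lies in
  its interior; hence the level set is the intersection of \<open>pierce_infinite\<close> with these interiors.
  The countably many exponents \<open>s m\<close> suffice since they tend to \<open>1\<close> and summability is monotone
  in the exponent.\<close>
lemma gdelta_in_conv_exp_level_1: "gdelta_in (top_of_set {0..1}) (conv_exp_level 1)"
proof -
  let ?X = "top_of_set {0..1::real}"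
  define s where "s m = 1 - inverse (real (Suc (Suc m)))" for m
  define f where "f m x n = recip_powr (pierce_digit (Suc n) x) (s m)" for m x n
  define G where "G m M = {x. \<exists>N. real M < sum (f m x) {..<N}}" for m and M :: nat
  have s: "0 < s m" "s m < 1" for m by (simp_all add: s_def field_simps)
  have G_nhds: "x \<in> interior (G m M)" if x: "x \<in> pierce_infinite" "x \<in> G m M" for x m M
  proof -
    obtain N where N: "real M < sum (f m x) {..<N}" using x(2) by (auto simp: G_def)
    have "eventually (\<lambda>y. \<forall>n\<in>{..<N}. pierce_digit (Suc n) y = pierce_digit (Suc n) x) (nhds x)"
      using eventually_pierce_digit_eq[OF x(1)] by (intro eventually_ball_finite) auto
    then have "eventually (\<lambda>y. y \<in> G m M) (nhds x)"
    proof eventually_elim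
      case (elim y)
      then have "sum (f m y) {..<N} = sum (f m x) {..<N}" by (intro sum.cong) (auto simp: f_def)
      then have "real M < sum (f m y) {..<N}" using N by simp
      then show ?case unfolding G_def by blast
    qed
    then show ?thesis by (auto simp: eventually_nhds interior_def)
  qed
  have level: "conv_exp x = 1 \<longleftrightarrow> (\<forall>m M. x \<in> G m M)" if x: "x \<in> {0..1}" for x
  proof -
    have "(\<forall>m M. x \<in> G m M) \<longleftrightarrow> (\<forall>m. \<not> summable (f m x))"
      using not_summable_nonneg_iff[of "f _ x"] by (auto simp: G_def f_def recip_powr_nonneg)
    also have "\<dots> \<longleftrightarrow> conv_exp x = 1"
      unfolding conv_exp_eq_1_iff[OF x]
    proof (intro iffI allI impI notI)
      fix t assume *: "\<forall>m. \<not> summable (f m x)" and t: "0 < t \<and> t < 1"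
        and summ: "summable (\<lambda>n. recip_powr (pierce_digit (Suc n) x) t)"
      obtain m where "inverse (real (Suc m)) < 1 - t" using reals_Archimedean[of "1 - t"] t by auto
      moreover have "inverse (real (Suc (Suc m))) \<le> inverse (real (Suc m))"
        by (intro le_imp_inverse_le) auto
      ultimately have "t \<le> s m" unfolding s_def by linarith
      then have "summable (f m x)" unfolding f_def by (rule summable_recip_powr_mono[OF summ])
      then show False using * by blast
    next
      fix m
      assume "\<forall>t. 0 < t \<and> t < 1 \<longrightarrow> \<not> summable (\<lambda>n. recip_powr (pierce_digit (Suc n) x) t)"
        and "summable (f m x)"
      then show False using s[of m] unfolding f_def by blast
    qed
    finally show ?thesis by simp
  qed
  have "gdelta_in ?X ({0..1} \<inter> interior (G m M))" for m M
    by (intro open_imp_gdelta_in openin_open_Int) simp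
  then have "gdelta_in ?X (\<Inter>((\<lambda>(m, M). {0..1} \<inter> interior (G m M)) ` UNIV))"
    by (intro gdelta_in_Inter) auto
  then have "gdelta_in ?X (pierce_infinite \<inter> \<Inter>((\<lambda>(m, M). {0..1} \<inter> interior (G m M)) ` UNIV))"
    by (intro gdelta_in_Int gdelta_in_pierce_infinite)
  moreover have "pierce_infinite \<inter> \<Inter>((\<lambda>(m, M). {0..1} \<inter> interior (G m M)) ` UNIV) = conv_exp_level 1"
  proof (intro set_eqI iffI)
    fix x assume "x \<in> pierce_infinite \<inter> \<Inter>((\<lambda>(m, M). {0..1} \<inter> interior (G m M)) ` UNIV)"
    then have "x \<in> {0..1}" "\<forall>m M. x \<in> G m M" using interior_subset by fastforce+
    then show "x \<in> conv_exp_level 1" using level by (simp add: conv_exp_level_def)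
  next
    fix x assume "x \<in> conv_exp_level 1"
    then have x: "x \<in> {0..1}" "conv_exp x = 1" by (auto simp: conv_exp_level_def)
    then have P: "x \<in> pierce_infinite" using pierce_finite_conv_exp by force
    then have "x \<in> interior (G m M)" for m M using G_nhds level x by blast
    then show "x \<in> pierce_infinite \<inter> \<Inter>((\<lambda>(m, M). {0..1} \<inter> interior (G m M)) ` UNIV)"
      using P x by auto
  qed
  ultimately show ?thesis by simp
qed


section \<open>Category of the level sets\<close>

theorem theorem1p8:
  shows "(\<forall>\<alpha>::real. 0 \<le> \<alpha> \<and> \<alpha> < 1 \<longrightarrow>
            dense_in (top_of_set {0..1}) (conv_exp_level \<alpha>) \<and>
            \<not> gdelta_in (top_of_set {0..1}) (conv_exp_level \<alpha>)) \<and>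
         dense_in (top_of_set {0..1}) (conv_exp_level 1) \<and>
         gdelta_in (top_of_set {0..1}) (conv_exp_level 1) \<and>
         (\<forall>\<alpha>::real. 0 \<le> \<alpha> \<and> \<alpha> < 1 \<longrightarrow>
            meager_in (top_of_set {0..1}) (conv_exp_level \<alpha>)) \<and>
         comeager_in (top_of_set {0..1}) (conv_exp_level 1) \<and>
         nonmeager_in (top_of_set {0..1}) (conv_exp_level 1)"
proof -
  let ?X = "top_of_set {0..1::real}"
  have X: "completely_metrizable_space ?X" "topspace ?X \<noteq> {}"
    using completely_metrizable_space_closedin[OF completely_metrizable_space_euclidean, of "{0..1::real}"]
    by auto
  have dense: "dense_in ?X (conv_exp_level a)" if "0 \<le> a" "a \<le> 1" for a
    using that conv_exp_attained_near_0 by (intro conv_exp_level_dense) auto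
  have comeager: "comeager_in ?X (conv_exp_level 1)"
    using dense gdelta_in_conv_exp_level_1 by (intro dense_gdelta_in_imp_comeager_in) auto
  have disjoint: "conv_exp_level 1 \<inter> conv_exp_level a = {}" if "a < 1" for a
    using that by (auto simp: conv_exp_level_def)
  have not_gdelta: "\<not> gdelta_in ?X (conv_exp_level a)" if "0 \<le> a" "a < 1" for a
    using disjoint_comeager_in_imp_False[OF X comeager _ disjoint[OF that(2)]]
      dense_gdelta_in_imp_comeager_in[OF dense] that by auto
  have meager: "meager_in ?X (conv_exp_level a)" if "a < 1" for a
  proof (rule meager_in_subset)
    show "meager_in ?X (topspace ?X - conv_exp_level 1)"
      using comeager by (simp add: comeager_in_def)
    show "conv_exp_level a \<subseteq> topspace ?X - conv_exp_level 1"
      using that by (auto simp: conv_exp_level_def)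
  qed
  have "nonmeager_in ?X (conv_exp_level 1)"
    unfolding nonmeager_in_def
  proof
    show sub: "conv_exp_level 1 \<subseteq> topspace ?X" by (auto simp: conv_exp_level_def)
    show "\<not> meager_in ?X (conv_exp_level 1)"
    proof
      assume "meager_in ?X (conv_exp_level 1)"
      then have "meager_in ?X (conv_exp_level 1 \<union> (topspace ?X - conv_exp_level 1))"
        using comeager by (intro meager_in_Un) (auto simp: comeager_in_def)
      moreover have "conv_exp_level 1 \<union> (topspace ?X - conv_exp_level 1) = topspace ?X"
        using sub by auto
      ultimately show False using completely_metrizable_not_meager_topspace[OF X] by simp
    qed
  qed
  then show ?thesis
    using dense not_gdelta gdelta_in_conv_exp_level_1 meager comeager by simp
qed

end
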